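(* Let $h_{k,n}$ be the number of column-convex polyominoes having $k$ columns and area $n$. For every integer $i\ge 0$, the quantity $h_{k,k+i}$, for $k\geq i+1$, is given by a polynomial in $k$ of degree $i$ whose leading coefficient (the coefficient of $k^i$) is equal to $\dfrac{4^i}{i!}$.
   Context: A cell is a unit square of the lattice $\mathbb{Z}^2$. A polyomino is a finite (nonempty) union of cells, connected through their edges, without a cut point, and considered up to translation. Its area is the number of its cells. A polyomino is column-convex if its intersection with any vertical line is connected; its number of columns is the number of vertical unit-width strips it occupies. *)

theory Defs
  imports "HOL-Analysis.Analysis" "HOL-Computational_Algebra.Polynomial"
begin

text \<open>A cell is named by its lower left corner, and a finite union of cells is represented by
  the set of its cells; \<open>region\<close> recovers the underlying point set in the plane.\<close>

type_synonym cell = "int \<times> int"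

definition square :: "cell \<Rightarrow> (real \<times> real) set" where
  "square c = {of_int (fst c) .. of_int (fst c) + 1} \<times> {of_int (snd c) .. of_int (snd c) + 1}"

definition region :: "cell set \<Rightarrow> (real \<times> real) set" where
  "region P = (\<Union>c\<in>P. square c)"

definition share_edge :: "cell \<Rightarrow> cell \<Rightarrow> bool" where
  "share_edge c d \<longleftrightarrow> \<bar>fst c - fst d\<bar> + \<bar>snd c - snd d\<bar> = 1"

definition edge_connected :: "cell set \<Rightarrow> bool" where
  "edge_connected P \<longleftrightarrow>
     (\<forall>c\<in>P. \<forall>d\<in>P. (c, d) \<in> {(a, b). a \<in> P \<and> b \<in> P \<and> share_edge a b}\<^sup>*)"

definition cut_point :: "(real \<times> real) set \<Rightarrow> real \<times> real \<Rightarrow> bool" where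
  "cut_point X p \<longleftrightarrow> p \<in> X \<and> connected X \<and> \<not> connected (X - {p})"

text \<open>Here a polyomino has a fixed position in the plane; translations are factored out in
  \<open>num_column_convex\<close>.\<close>

definition polyomino :: "cell set \<Rightarrow> bool" where
  "polyomino P \<longleftrightarrow>
     finite P \<and> P \<noteq> {} \<and> edge_connected P \<and> (\<nexists>p. cut_point (region P) p)"

definition column_convex :: "cell set \<Rightarrow> bool" where
  "column_convex P \<longleftrightarrow> (\<forall>x. connected (region P \<inter> {p. fst p = x}))"

definition area :: "cell set \<Rightarrow> nat" where
  "area P = card P"

definition num_columns :: "cell set \<Rightarrow> nat" where
  "num_columns P = card (fst ` P)"

definition translate :: "cell \<Rightarrow> cell set \<Rightarrow> cell set" where
  "translate v P = (\<lambda>c. c + v) ` P"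

definition translation_rel :: "(cell set \<times> cell set) set" where
  "translation_rel = {(P, Q). \<exists>v. Q = translate v P}"

definition num_column_convex :: "nat \<Rightarrow> nat \<Rightarrow> nat" where
  "num_column_convex k n =
     card ({P. polyomino P \<and> column_convex P \<and> num_columns P = k \<and> area P = n} // translation_rel)"

end

theory Submission
  imports Defs "HOL-Computational_Algebra.Formal_Power_Series"
begin

text \<open>
  The intersections with vertical lines force each column of a column-convex polyomino to be an
  interval of cells, and connectedness through edges forces consecutive columns to share a row.
  Conversely, every sequence of intervals in which consecutive ones meet gives such a polyomino;
  cut points never occur, because a square stays connected when a point is removed and two
  squares with a common edge then still meet. So a polyomino with \<open>k\<close> columns
  and area \<open>k + i\<close> is the same thing, up to translation, as a sequence of \<open>k\<close> columns with \<open>1 + e\<^sub>j\<close> cells and total excess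
  \<open>e\<^sub>1 + \<dots> + e\<^sub>k = i\<close>, together with a choice of relative position for each consecutive pair. Two
  intervals with \<open>1 + e\<close> and \<open>1 + e'\<close> cells meet in \<open>1 + e + e'\<close> relative positions
  (\<open>num_column_convex_conv_shape_count\<close>).

  The weight \<open>(1 + e) + e'\<close> is a sum of two terms depending on one column each, so the transfer
  matrix has rank two: adding a column only involves the number of shapes and the sum of their first
  excesses. With \<open>X\<close> marking the excess, \<open>u = 1 - X\<close>, and \<open>\<alpha>\<close>, \<open>\<beta>\<close> the two power series with
  \<open>\<lambda>\<^sup>2 = (1 + X) \<lambda> + X\<close>, the generating function for \<open>k\<close> columns is
  \<open>u / (\<alpha> - \<beta>) * ((\<alpha> / u\<^sup>2) ^ k - (\<beta> / u\<^sup>2) ^ k)\<close>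
  (\<open>shape_series_closed_form\<close>). Since \<open>\<beta>\<close> has constant term \<open>0\<close>, the second power is divisible
  by \<open>X ^ k\<close> and does not reach the coefficient of \<open>X ^ i\<close> when \<open>k > i\<close>; this is where the bound
  on \<open>k\<close> comes from. What remains is a coefficient of \<open>F * H ^ k\<close> with
  \<open>H = \<alpha> / u\<^sup>2 = 1 + 4 X + \<dots>\<close> and \<open>F = 1 + \<dots>\<close>. Expanding \<open>H ^ k\<close> by the binomial theorem
  in powers of \<open>H - 1\<close> shows that it is a polynomial in \<open>k\<close> whose coefficient at \<open>k ^ i\<close> is
  \<open>4 ^ i / fact i\<close> (\<open>fps_nth_mult_power_polynomial\<close>).
\<close>

section \<open>Regions of cells\<close>

lemma mem_region:
  "(x, t) \<in> region P \<longleftrightarrow>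
     (\<exists>c\<in>P. of_int (fst c) \<le> x \<and> x \<le> of_int (fst c) + 1 \<and> of_int (snd c) \<le> t \<and> t \<le> of_int (snd c) + 1)"
  by (auto simp: region_def square_def)

text \<open>Reduces column-convexity to subsets of the real line, where connected sets are intervals.\<close>

lemma connected_region_vertical_line:
  "connected (region P \<inter> {p. fst p = x}) \<longleftrightarrow> connected {t. (x, t) \<in> region P}"
proof
  assume "connected (region P \<inter> {p. fst p = x})"
  then have "connected (snd ` (region P \<inter> {p. fst p = x}))"
    by (intro connected_continuous_image continuous_intros)
  also have "snd ` (region P \<inter> {p. fst p = x}) = {t. (x, t) \<in> region P}"
    by force
  finally show "connected {t. (x, t) \<in> region P}" .
next
  assume "connected {t. (x, t) \<in> region P}"
  then have "connected (Pair x ` {t. (x, t) \<in> region P})"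
    by (intro connected_continuous_image continuous_intros)
  also have "Pair x ` {t. (x, t) \<in> region P} = region P \<inter> {p. fst p = x}"
    by auto
  finally show "connected (region P \<inter> {p. fst p = x})" .
qed

lemma connected_square_minus_point: "connected (square c - {p})"
proof (rule connected_convex_diff_countable)
  show "convex (square c)"
    unfolding square_def by (intro convex_Times convex_real_interval)
  define a where "a = (of_int (fst c) :: real, of_int (snd c) :: real)"
  have "a \<in> square c" "a + (1, 0) \<in> square c" "a + (0, 1) \<in> square c"
    by (auto simp: a_def square_def)
  show "\<not> collinear (square c)"
  proof
    assume "collinear (square c)"
    then obtain u where u: "\<And>x y. x \<in> square c \<Longrightarrow> y \<in> square c \<Longrightarrow> \<exists>r. x - y = r *\<^sub>R u"
      unfolding collinear_def by blast
    have "\<exists>r. (1, 0) = r *\<^sub>R u" "\<exists>s. (0, 1) = s *\<^sub>R u"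
      using u[of "a + (1, 0)" a] u[of "a + (0, 1)" a] \<open>a \<in> _\<close> \<open>a + (1, 0) \<in> _\<close> \<open>a + (0, 1) \<in> _\<close>
      by simp_all
    then obtain r s where "(1, 0) = r *\<^sub>R u" "(0, 1) = s *\<^sub>R u"
      by blast
    then show False
      by (cases u) (auto simp: zero_prod_def)
  qed
qed auto

lemma share_edge_cases:
  assumes "share_edge c d"
  obtains "d = (fst c + 1, snd c)" | "d = (fst c - 1, snd c)"
    | "d = (fst c, snd c + 1)" | "d = (fst c, snd c - 1)"
proof -
  define x y where "x = fst d - fst c" and "y = snd d - snd c"
  have "\<bar>x\<bar> + \<bar>y\<bar> = 1"
    using assms by (simp add: share_edge_def x_def y_def abs_minus_commute)
  then have "(x, y) \<in> {(1, 0), (- 1, 0), (0, 1), (0, - 1)}"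
    by (auto simp: abs_if split: if_splits)
  moreover have "d = (fst c + x, snd c + y)"
    by (simp add: x_def y_def)
  ultimately show ?thesis
    using that by auto
qed

lemma squares_sharing_edge_meet_off_point:
  assumes "share_edge c d"
  shows "(square c - {p}) \<inter> (square d - {p}) \<noteq> {}"
proof -
  define x y where "x = (of_int (fst c) :: real)" and "y = (of_int (snd c) :: real)"
  have "\<exists>q r. q \<noteq> r \<and> {q, r} \<subseteq> square c \<inter> square d"
    using assms
  proof (cases rule: share_edge_cases)
    case 1
    then show ?thesis
      by (intro exI[of _ "(x + 1, y)"] exI[of _ "(x + 1, y + 1)"]) (auto simp: square_def x_def y_def)
  next
    case 2
    then show ?thesis
      by (intro exI[of _ "(x, y)"] exI[of _ "(x, y + 1)"]) (auto simp: square_def x_def y_def)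
  next
    case 3
    then show ?thesis
      by (intro exI[of _ "(x, y + 1)"] exI[of _ "(x + 1, y + 1)"]) (auto simp: square_def x_def y_def)
  next
    case 4
    then show ?thesis
      by (intro exI[of _ "(x, y)"] exI[of _ "(x + 1, y)"]) (auto simp: square_def x_def y_def)
  qed
  then show ?thesis by blast
qed

text \<open>Along a path of cells, the squares without \<open>p\<close> can be united one after the other: two squares
  with a common edge still share one of its end points. Hence the condition on cut points in the
  definition of a polyomino follows from connectedness through edges.\<close>

lemma edge_connected_no_cut_point:
  assumes "edge_connected P"
  shows "\<not> cut_point (region P) p"
proof -
  have "connected (region P - {p})"
    unfolding connected_iff_connected_component
  proof (intro ballI)
    fix q r assume "q \<in> region P - {p}" "r \<in> region P - {p}"
    then obtain c d where cd: "c \<in> P" "d \<in> P" and q: "q \<in> square c - {p}" and r: "r \<in> square d - {p}"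
      by (auto simp: region_def)
    have "(c, d) \<in> {(a, b). a \<in> P \<and> b \<in> P \<and> share_edge a b}\<^sup>*"
      using assms cd unfolding edge_connected_def by blast
    then have "\<exists>T. connected T \<and> T \<subseteq> region P - {p} \<and> square c - {p} \<subseteq> T \<and> square d - {p} \<subseteq> T"
    proof induction
      case base
      then show ?case
        using cd(1) connected_square_minus_point[of c p]
        by (intro exI[of _ "square c - {p}"]) (auto simp: region_def)
    next
      case (step a b)
      then obtain T where T: "connected T" "T \<subseteq> region P - {p}" "square c - {p} \<subseteq> T"
          "square a - {p} \<subseteq> T" and b: "b \<in> P" "share_edge a b"
        by blast
      have "connected (T \<union> (square b - {p}))"
        using squares_sharing_edge_meet_off_point[OF b(2), of p] T(1,4)
        by (intro connected_Un connected_square_minus_point) auto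
      then show ?case
        using T b(1) by (intro exI[of _ "T \<union> (square b - {p})"]) (auto simp: region_def)
    qed
    then show "connected_component (region P - {p}) q r"
      using q r unfolding connected_component_def by blast
  qed
  then show ?thesis
    by (simp add: cut_point_def)
qed

section \<open>Polyominoes built from lists of columns\<close>

text \<open>A column is encoded by its lowest row and its excess, which is its number of cells minus one.
  Every pair then encodes a nonempty interval, and the area of a polyomino with \<open>k\<close> columns exceeds
  \<open>k\<close> by the sum of the excesses.\<close>

definition column_rows :: "int \<times> nat \<Rightarrow> int set" where
  "column_rows c = {fst c .. fst c + int (snd c)}"

definition columns_touch :: "int \<times> nat \<Rightarrow> int \<times> nat \<Rightarrow> bool" where
  "columns_touch c d \<longleftrightarrow> column_rows c \<inter> column_rows d \<noteq> {}"

definition cells :: "(int \<times> nat) list \<Rightarrow> cell set" where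
  "cells cs = {(int j, y) | j y. j < length cs \<and> y \<in> column_rows (cs ! j)}"

text \<open>Two intervals of integers meet iff each starts no later than the other ends. For fixed \<open>b\<close> this
  leaves \<open>1 + e + e'\<close> values of \<open>b'\<close>, the factor contributed by two consecutive columns.\<close>

lemma columns_touch_iff:
  "columns_touch (b, e) (b', e') \<longleftrightarrow> b' \<in> {b - int e' .. b + int e}"
proof
  assume "b' \<in> {b - int e' .. b + int e}"
  \<comment> \<open>The higher of the two bottom rows lies in both columns.\<close>
  then have "max b b' \<in> column_rows (b, e) \<inter> column_rows (b', e')"
    by (auto simp: column_rows_def)
  then show "columns_touch (b, e) (b', e')"
    unfolding columns_touch_def by blast
qed (auto simp: columns_touch_def column_rows_def)

lemma cells_conv_Union: "cells cs = (\<Union>j<length cs. {int j} \<times> column_rows (cs ! j))"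
  by (auto simp: cells_def)

lemma finite_cells: "finite (cells cs)"
  by (auto simp: cells_conv_Union column_rows_def)

lemma card_cells: "card (cells cs) = length cs + sum_list (map snd cs)"
proof -
  have "card (cells cs) = (\<Sum>j<length cs. card ({int j} \<times> column_rows (cs ! j)))"
    unfolding cells_conv_Union by (rule card_UN_disjoint) (auto simp: column_rows_def)
  also have "\<dots> = (\<Sum>j<length cs. Suc (snd (cs ! j)))"
  proof -
    have "card (column_rows c) = Suc (snd c)" for c
      unfolding column_rows_def by simp
    then show ?thesis
      by (simp add: card_cartesian_product)
  qed
  also have "\<dots> = length cs + sum_list (map snd cs)"
    by (simp add: sum_list_sum_nth atLeast0LessThan sum_Suc)
  finally show ?thesis .
qed

lemma fst_cells: "fst ` cells cs = int ` {..<length cs}"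
  by (force simp: cells_def column_rows_def)

lemma num_columns_cells: "num_columns (cells cs) = length cs"
  by (simp add: num_columns_def fst_cells card_image)

text \<open>A vertical line meets the closed squares of one column or, at an integer abscissa, of two
  consecutive columns. Each column contributes a segment, and the two segments overlap because the
  columns share a row.\<close>

lemma column_convex_cells:
  assumes "successively columns_touch cs"
  shows "column_convex (cells cs)"
  unfolding column_convex_def connected_region_vertical_line
proof
  fix x :: real
  define seg where "seg j = {real_of_int (fst (cs ! j)) .. real_of_int (fst (cs ! j)) + real (snd (cs ! j)) + 1}" for j
  define J where "J = {j. j < length cs \<and> real j \<le> x \<and> x \<le> real j + 1}"
  have line: "{t. (x, t) \<in> region (cells cs)} = (\<Union>j\<in>J. seg j)" (is "?L = ?R")
  proof (intro set_eqI iffI)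
    fix t assume "t \<in> ?L"
    then obtain j y where j: "j < length cs" "y \<in> column_rows (cs ! j)" "real j \<le> x" "x \<le> real j + 1"
        and t: "real_of_int y \<le> t" "t \<le> real_of_int y + 1"
      by (auto simp: mem_region cells_def)
    have "real_of_int (fst (cs ! j)) \<le> real_of_int y"
         "real_of_int y \<le> real_of_int (fst (cs ! j)  + int (snd (cs ! j)))"
      using j(2) unfolding column_rows_def of_int_le_iff by auto
    then have "t \<in> seg j" using t by (simp add: seg_def)
    then show "t \<in> ?R" using j by (auto simp: J_def)
  next
    fix t assume "t \<in> ?R"
    then obtain j where j: "j < length cs" "real j \<le> x" "x \<le> real j + 1" and t: "t \<in> seg j"
      by (auto simp: J_def)
    \<comment> \<open>The minimum matters at the top end of the segment, which lies in the square below it.\<close>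
    define y where "y = min \<lfloor>t\<rfloor> (fst (cs ! j) + int (snd (cs ! j)))"
    have "y \<in> column_rows (cs ! j)" "real_of_int y \<le> t" "t \<le> real_of_int y + 1"
      using t unfolding y_def column_rows_def seg_def by (auto simp: min_def le_floor_iff) linarith+
    then show "t \<in> ?L"
      using j by (force simp: mem_region cells_def)
  qed
  have meet: "seg j \<inter> seg j' \<noteq> {}" if "j \<in> J" "j' \<in> J" "j \<le> j'" for j j'
  proof -
    have "j' \<le> Suc j"
      using that by (auto simp: J_def)
    then consider "j' = j" | "j' = Suc j"
      using \<open>j \<le> j'\<close> by linarith
    then show ?thesis
    proof cases
      case 2
      then have "columns_touch (cs ! j) (cs ! j')"
        using assms that by (simp add: successively_conv_nth J_def)
      then obtain y where "y \<in> column_rows (cs ! j)" "y \<in> column_rows (cs ! j')"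
        by (auto simp: columns_touch_def)
      then have "real_of_int y \<in> seg j \<inter> seg j'"
        unfolding column_rows_def seg_def by auto
      then show ?thesis by blast
    qed (simp add: seg_def)
  qed
  have "connected (\<Union>j\<in>J. seg j)"
    unfolding connected_iff_connected_component
  proof (intro ballI)
    fix s t assume "s \<in> (\<Union>j\<in>J. seg j)" "t \<in> (\<Union>j\<in>J. seg j)"
    then obtain j j' where jj: "j \<in> J" "s \<in> seg j" "j' \<in> J" "t \<in> seg j'"
      by blast
    have "seg j \<inter> seg j' \<noteq> {}"
      using meet[of j j'] meet[of j' j] jj by (cases "j \<le> j'") auto
    then have "connected (seg j \<union> seg j')"
      by (intro connected_Un) (auto simp: seg_def)
    then show "connected_component (\<Union>j\<in>J. seg j) s t"
      using jj unfolding connected_component_def by blast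
  qed
  then show "connected {t. (x, t) \<in> region (cells cs)}"
    unfolding line .
qed

text \<open>Every cell is reached from the bottom of the first column: pass from each column to the next in
  a row that they share, and move vertically in between.\<close>

lemma edge_connected_cells:
  assumes "successively columns_touch cs"
  shows "edge_connected (cells cs)"
proof -
  define P where "P = cells cs"
  define R where "R = {(a, b). a \<in> P \<and> b \<in> P \<and> share_edge a b}"
  have "sym R"
    by (auto simp: R_def sym_def share_edge_def)
  then have sym: "(b, a) \<in> R\<^sup>*" if "(a, b) \<in> R\<^sup>*" for a b
    using that sym_rtrancl symD by metis
  have mem: "(int j, y) \<in> P \<longleftrightarrow> j < length cs \<and> y \<in> column_rows (cs ! j)" for j y
    by (auto simp: P_def cells_def)
  have up: "((x, y), (x, y + int n)) \<in> R\<^sup>*"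
    if "(x, y) \<in> P" "(x, y + int n) \<in> P" for x y n
    using that
  proof (induction n)
    case (Suc n)
    then have "(x, y + int n) \<in> P"
      by (auto simp: P_def cells_def column_rows_def)
    moreover from this Suc.prems have "((x, y + int n), (x, y + int (Suc n))) \<in> R"
      by (auto simp: R_def share_edge_def)
    ultimately show ?case
      using Suc by (meson rtrancl.rtrancl_into_rtrancl)
  qed simp
  have vertical: "((x, y), (x, y')) \<in> R\<^sup>*" if "(x, y) \<in> P" "(x, y') \<in> P" for x y y'
  proof (cases "y \<le> y'")
    case True
    then show ?thesis
      using up[of x y "nat (y' - y)"] that by simp
  next
    case False
    then show ?thesis
      using up[of x y' "nat (y - y')"] that sym by simp
  qed
  have from_origin: "((0, fst (cs ! 0)), (int j, y)) \<in> R\<^sup>*" if "(int j, y) \<in> P" for j y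
    using that
  proof (induction j arbitrary: y)
    case 0
    then show ?case
      using vertical[of 0 "fst (cs ! 0)" y] mem[of 0] by (simp add: column_rows_def)
  next
    case (Suc j)
    then have "columns_touch (cs ! j) (cs ! Suc j)"
      using assms unfolding mem successively_conv_nth by blast
    then obtain z where z: "z \<in> column_rows (cs ! j)" "z \<in> column_rows (cs ! Suc j)"
      by (auto simp: columns_touch_def)
    then have zP: "(int j, z) \<in> P" "(int (Suc j), z) \<in> P"
      using Suc.prems by (simp_all only: mem) auto
    then have "((int j, z), (int (Suc j), z)) \<in> R"
      by (auto simp: R_def share_edge_def)
    with Suc.IH[OF zP(1)] vertical[OF zP(2) Suc.prems] show ?case
      by (meson rtrancl.rtrancl_into_rtrancl rtrancl_trans)
  qed
  have "(c, d) \<in> R\<^sup>*" if cd: "c \<in> P" "d \<in> P" for c d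
  proof -
    obtain j y where "c = (int j, y)"
      using cd(1) unfolding P_def cells_def by blast
    moreover obtain j' y' where "d = (int j', y')"
      using cd(2) unfolding P_def cells_def by blast
    ultimately show ?thesis
      using from_origin cd sym by (meson rtrancl_trans)
  qed
  then show ?thesis
    unfolding edge_connected_def R_def P_def by blast
qed

lemma polyomino_cells:
  assumes "cs \<noteq> []" "successively columns_touch cs"
  shows "polyomino (cells cs)"
proof -
  have "fst ` cells cs \<noteq> {}"
    using assms(1) unfolding fst_cells by auto
  then have "cells cs \<noteq> {}"
    by blast
  then show ?thesis
    using edge_connected_cells[OF assms(2)] edge_connected_no_cut_point
    by (auto simp: polyomino_def finite_cells)
qed

section \<open>Normal form of column-convex polyominoes\<close>

lemma column_convex_interval:
  assumes "column_convex P" "(x, y1) \<in> P" "(x, y2) \<in> P" "y1 \<le> y" "y \<le> y2"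
  shows "(x, y) \<in> P"
proof (cases "y1 = y \<or> y = y2")
  case False
  \<comment> \<open>Cut through the middle of the column, and look at the height of the middle of the cell.\<close>
  define X where "X = real_of_int x + 1 / 2"
  define L where "L = {t. (X, t) \<in> region P}"
  have mem: "t \<in> L \<longleftrightarrow> (\<exists>z. (x, z) \<in> P \<and> of_int z \<le> t \<and> t \<le> of_int z + 1)" for t
  proof -
    have "of_int a \<le> X \<and> X \<le> of_int a + 1 \<longleftrightarrow> a = x" for a
      unfolding X_def by linarith
    moreover have "(X, t) \<in> region P \<longleftrightarrow> (\<exists>a z. (a, z) \<in> P \<and>
        (of_int a \<le> X \<and> X \<le> of_int a + 1) \<and> of_int z \<le> t \<and> t \<le> of_int z + 1)"
      by (simp add: mem_region Bex_def split_paired_Ex conj_assoc)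
    ultimately show ?thesis
      by (simp add: L_def)
  qed
  have "connected L"
    using assms(1) unfolding column_convex_def connected_region_vertical_line L_def by blast
  moreover have "real_of_int y1 \<in> L" "real_of_int y2 \<in> L"
    using assms(2,3) by (auto simp: mem)
  moreover have "real_of_int y1 \<le> real_of_int y + 1 / 2" "real_of_int y + 1 / 2 \<le> real_of_int y2"
    using assms False by linarith+
  ultimately have "real_of_int y + 1 / 2 \<in> L"
    unfolding connected_iff_interval by blast
  then obtain z where z: "(x, z) \<in> P" "of_int z \<le> real_of_int y + 1 / 2" "real_of_int y + 1 / 2 \<le> of_int z + 1"
    unfolding mem by blast
  then have "z = y"
    by linarith
  with z show ?thesis by simp
qed (use assms in auto)

text \<open>A path of cells from the left to the right of the line between the columns \<open>x\<close> and \<open>x + 1\<close>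
  has a step across that line, and this step is horizontal.\<close>

lemma edge_connected_crossing:
  assumes "edge_connected P" "c \<in> P" "d \<in> P" "fst c \<le> x" "x < fst d"
  shows "\<exists>y. (x, y) \<in> P \<and> (x + 1, y) \<in> P"
proof -
  have "(c, d) \<in> {(a, b). a \<in> P \<and> b \<in> P \<and> share_edge a b}\<^sup>*"
    using assms unfolding edge_connected_def by blast
  then have "fst d \<le> x \<or> (\<exists>y. (x, y) \<in> P \<and> (x + 1, y) \<in> P)"
  proof induction
    case (step a b)
    then have ab: "a \<in> P" "b \<in> P" "share_edge a b"
      by auto
    show ?case
    proof (cases "fst a \<le> x \<and> \<not> fst b \<le> x")
      case True
      with ab(3) have "fst b = fst a + 1" "snd b = snd a"
        by (cases rule: share_edge_cases; simp)+
      with True have "fst a = x" "fst b = x + 1" "snd b = snd a"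
        by linarith+
      with ab(1,2) have "(x, snd a) \<in> P" "(x + 1, snd a) \<in> P"
        by (metis prod.collapse)+
      then show ?thesis by blast
    qed (use step.IH in blast)
  qed (use assms in simp)
  with assms show ?thesis by simp
qed

lemma interval_eq_column_rows:
  fixes S :: "int set"
  assumes "finite S" "S \<noteq> {}" "\<And>a b y. a \<in> S \<Longrightarrow> b \<in> S \<Longrightarrow> a \<le> y \<Longrightarrow> y \<le> b \<Longrightarrow> y \<in> S"
  shows "\<exists>c. S = column_rows c"
proof -
  define l h where "l = Min S" and "h = Max S"
  have "l \<in> S" "h \<in> S" "S \<subseteq> {l..h}"
    using assms(1,2) by (auto simp: l_def h_def)
  then have "S = {l..h}"
    using assms(3)[of l h] by auto
  moreover have "l \<le> h"
    using \<open>l \<in> S\<close> \<open>S \<subseteq> {l..h}\<close> by auto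
  ultimately have "S = column_rows (l, nat (h - l))"
    by (simp add: column_rows_def)
  then show ?thesis ..
qed

lemma mem_translate: "c \<in> translate v P \<longleftrightarrow> c - v \<in> P"
  unfolding translate_def image_iff by (metis add_diff_cancel_right' diff_add_cancel)

text \<open>By \<open>edge_connected_crossing\<close> no column between the first and the last is empty and consecutive
  columns share a row; by \<open>column_convex_interval\<close> each column is an interval. Moving the lowest cell
  of the first column to the origin singles out one representative in each translation class.\<close>

lemma column_convex_polyomino_normal_form:
  assumes "polyomino P" "column_convex P"
  obtains v cs where "P = translate v (cells cs)" "cs \<noteq> []" "successively columns_touch cs"
    "fst (hd cs) = 0"
proof -
  have P: "finite P" "P \<noteq> {}" "edge_connected P"
    using assms(1) by (auto simp: polyomino_def)
  define a m where "a = Min (fst ` P)" and "m = Max (fst ` P)"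
  have am: "a \<in> fst ` P" "m \<in> fst ` P" and bounds: "\<And>c. c \<in> P \<Longrightarrow> a \<le> fst c \<and> fst c \<le> m"
    using P by (auto simp: a_def m_def)
  then have "a \<le> m" by auto
  define k where "k = nat (m - a)"
  have m: "m = a + int k"
    using \<open>a \<le> m\<close> by (simp add: k_def)
  have cross: "\<exists>y. (a + int j, y) \<in> P \<and> (a + int j + 1, y) \<in> P" if "j < k" for j
  proof -
    obtain c d where "c \<in> P" "fst c = a" "d \<in> P" "fst d = m"
      using am by auto
    then show ?thesis
      using that by (intro edge_connected_crossing[OF P(3), of c d]) (auto simp: m)
  qed
  have "\<exists>c. {y. (a + int j, y) \<in> P} = column_rows c" if "j \<le> k" for j
  proof (rule interval_eq_column_rows)
    show "finite {y. (a + int j, y) \<in> P}"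
      by (rule finite_subset[of _ "snd ` P"]) (use P in force)+
    show "{y. (a + int j, y) \<in> P} \<noteq> {}"
      using cross[of j] am(2) that by (cases "j = k") (auto simp: m)
  qed (use column_convex_interval[OF assms(2)] in blast)
  then obtain c where c: "\<And>j. j \<le> k \<Longrightarrow> {y. (a + int j, y) \<in> P} = column_rows (c j)"
    by metis
  define b where "b = fst (c 0)"
  define cs where "cs = map (\<lambda>j. (fst (c j) - b, snd (c j))) [0..<Suc k]"
  have len: "length cs = Suc k"
    by (simp add: cs_def)
  have col: "y \<in> column_rows (cs ! j) \<longleftrightarrow> (a + int j, y + b) \<in> P" if "j \<le> k" for j y
  proof -
    have "y \<in> column_rows (cs ! j) \<longleftrightarrow> y + b \<in> column_rows (c j)"
      using that unfolding cs_def column_rows_def by (auto simp del: upt_Suc)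
    then show ?thesis
      using c[OF that] by blast
  qed
  have "P = translate (a, b) (cells cs)"
  proof (rule set_eqI)
    fix z :: cell
    obtain x y where z: "z = (x, y)" by fastforce
    show "z \<in> P \<longleftrightarrow> z \<in> translate (a, b) (cells cs)"
    proof (cases "a \<le> x \<and> x \<le> m")
      case True
      define j where "j = nat (x - a)"
      have x: "x = a + int j" and "j \<le> k"
        using True by (auto simp: j_def m)
      then show ?thesis
        using col[of j "y - b"] by (auto simp: z mem_translate cells_def len)
    next
      case False
      then show ?thesis
        using bounds[of z] by (auto simp: z mem_translate cells_def len m)
    qed
  qed
  moreover have "successively columns_touch cs"
    unfolding successively_conv_nth
  proof (intro allI impI)
    fix j assume j: "Suc j < length cs"
    then obtain y where y: "(a + int j, y) \<in> P" "(a + int j + 1, y) \<in> P"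
      using cross[of j] by (auto simp: len)
    then have "y - b \<in> column_rows (cs ! j)" "y - b \<in> column_rows (cs ! Suc j)"
      using j col[of j "y - b"] col[of "Suc j" "y - b"] by (auto simp: len add_ac)
    then show "columns_touch (cs ! j) (cs ! Suc j)"
      unfolding columns_touch_def by blast
  qed
  moreover have "cs \<noteq> []" "fst (hd cs) = 0"
    by (simp_all add: cs_def hd_map b_def del: upt_Suc)
  ultimately show ?thesis by (intro that)
qed

lemma column_rows_inject: "column_rows c = column_rows d \<longleftrightarrow> c = d"
  by (auto simp: column_rows_def prod_eq_iff)

text \<open>Both sets start in abscissa \<open>0\<close> with a column whose lowest row is \<open>0\<close>, so the translation is
  trivial, and a set of cells determines its columns.\<close>

lemma translate_cells_eqD:
  assumes "translate v (cells cs) = cells ds" "cs \<noteq> []" "ds \<noteq> []"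
    "fst (hd cs) = 0" "fst (hd ds) = 0"
  shows "cs = ds"
proof -
  have eq: "(x, y) \<in> cells ds \<longleftrightarrow> (x - fst v, y - snd v) \<in> cells cs" for x y
    using mem_translate[of "(x, y)" v "cells cs"] assms(1) by (cases v) auto
  have fsts: "x \<in> int ` {..<length ds} \<longleftrightarrow> x - fst v \<in> int ` {..<length cs}" for x
  proof -
    have "x \<in> fst ` C \<longleftrightarrow> (\<exists>y. (x, y) \<in> C)" for x and C :: "cell set"
      by force
    then show ?thesis
      unfolding fst_cells[symmetric] by (metis eq add_diff_cancel_right')
  qed
  have mem: "(int j, y) \<in> cells bs \<longleftrightarrow> j < length bs \<and> y \<in> column_rows (bs ! j)" for j y bs
    by (auto simp: cells_def)
  have "0 - fst v \<in> int ` {..<length cs}" "fst v \<in> int ` {..<length ds}"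
    using fsts[of 0] fsts[of "fst v"] assms(2,3) by (auto intro!: image_eqI[of _ int 0])
  then have v1: "fst v = 0" by auto
  have len: "length cs = length ds"
    using fsts v1 num_columns_cells
    by (metis (no_types, lifting) assms(1) diff_zero eq num_columns_def fst_cells set_eqI)
  have col: "y \<in> column_rows (ds ! j) \<longleftrightarrow> y - snd v \<in> column_rows (cs ! j)" if "j < length cs" for j y
    using eq[of "int j" y] that by (simp add: v1 mem len)
  have "snd v = 0"
    using col[of 0 0] col[of 0 "snd v"] assms(2-5) by (auto simp: column_rows_def hd_conv_nth)
  then show ?thesis
    using col len by (intro nth_equalityI) (auto simp: column_rows_inject[symmetric])
qed

lemma equiv_translation_rel: "equiv UNIV translation_rel"
proof (rule equivI)
  have trans: "translate v (translate w P) = translate (v + w) P" for v w P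
    by (rule set_eqI) (simp add: mem_translate algebra_simps)
  have zero: "translate 0 P = P" for P
    by (rule set_eqI) (simp add: mem_translate)
  show "refl translation_rel"
  proof (rule reflI)
    fix P show "(P, P) \<in> translation_rel"
      using zero[of P, symmetric] unfolding translation_rel_def by blast
  qed
  show "sym translation_rel"
  proof (rule symI)
    fix P Q assume "(P, Q) \<in> translation_rel"
    then obtain v where "Q = translate v P"
      by (auto simp: translation_rel_def)
    then have "P = translate (- v) Q"
      by (simp add: trans zero)
    then show "(Q, P) \<in> translation_rel"
      unfolding translation_rel_def by blast
  qed
  show "trans translation_rel"
  proof (rule transI)
    fix P Q R assume "(P, Q) \<in> translation_rel" "(Q, R) \<in> translation_rel"
    then obtain v w where "Q = translate v P" "R = translate w Q"
      by (auto simp: translation_rel_def)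
    then have "R = translate (w + v) P"
      by (simp add: trans)
    then show "(P, R) \<in> translation_rel"
      unfolding translation_rel_def by blast
  qed
qed auto

section \<open>Counting by transfer between columns\<close>

text \<open>Shapes with \<open>k + 1\<close> columns, so that the first column always exists. The first column \<open>(b, e)\<close>
  is kept as a parameter because it governs how a new column can be placed in front of it.\<close>

definition column_lists :: "nat \<Rightarrow> nat \<Rightarrow> int \<Rightarrow> nat \<Rightarrow> (int \<times> nat) list set" where
  "column_lists k i b e =
     {cs. length cs = Suc k \<and> sum_list (map snd cs) = i \<and> hd cs = (b, e) \<and> successively columns_touch cs}"

text \<open>Each translation class contains \<open>cells cs\<close> for exactly one list \<open>cs\<close> whose first column starts
  in row \<open>0\<close>; the union runs over the excess of that column, which is at most the total \<open>i\<close>.\<close>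

lemma num_column_convex_conv_lists:
  "num_column_convex (Suc k) (Suc k + i) = card (\<Union>e\<le>i. column_lists k i 0 e)"
proof -
  define V where "V = {P. polyomino P \<and> column_convex P \<and> num_columns P = Suc k \<and> area P = Suc k + i}"
  define L where "L = {cs. length cs = Suc k \<and> sum_list (map snd cs) = i \<and> fst (hd cs) = 0 \<and>
     successively columns_touch cs}"
  define cls where "cls cs = translation_rel `` {cells cs}" for cs
  have nonempty: "cs \<noteq> []" if "cs \<in> L" for cs
    using that by (auto simp: L_def)
  have inV: "cells cs \<in> V" if "cs \<in> L" for cs
    using that nonempty[OF that] polyomino_cells[of cs] column_convex_cells[of cs]
    by (auto simp: V_def L_def num_columns_cells area_def card_cells)
  have "bij_betw cls L (V // translation_rel)"
    unfolding bij_betw_def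
  proof
    show "inj_on cls L"
    proof (rule inj_onI)
      fix cs ds assume "cs \<in> L" "ds \<in> L" "cls cs = cls ds"
      then have "(cells cs, cells ds) \<in> translation_rel"
        using eq_equiv_class[OF _ equiv_translation_rel] by (simp add: cls_def)
      then obtain v where "translate v (cells cs) = cells ds"
        by (auto simp: translation_rel_def)
      then show "cs = ds"
        by (rule translate_cells_eqD) (use \<open>cs \<in> L\<close> \<open>ds \<in> L\<close> nonempty in \<open>auto simp: L_def\<close>)
    qed
    show "cls ` L = V // translation_rel"
    proof
      show "cls ` L \<subseteq> V // translation_rel"
        using inV by (auto simp: cls_def intro: quotientI)
      show "V // translation_rel \<subseteq> cls ` L"
      proof
        fix X assume "X \<in> V // translation_rel"
        then obtain P where PV: "P \<in> V" and X: "X = translation_rel `` {P}"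
          by (rule quotientE)
        then obtain v cs where P: "P = translate v (cells cs)" and cs: "cs \<noteq> []"
            "successively columns_touch cs" "fst (hd cs) = 0"
          unfolding V_def by (blast elim: column_convex_polyomino_normal_form)
        have "(cells cs, P) \<in> translation_rel"
          using P unfolding translation_rel_def by blast
        then have "X = cls cs"
          unfolding X cls_def using equiv_class_eq[OF equiv_translation_rel] by blast
        moreover have "area P = area (cells cs)"
          unfolding P area_def translate_def by (rule card_image) auto
        moreover have "fst ` P = (\<lambda>x. x + fst v) ` fst ` cells cs"
          by (simp add: P translate_def image_image)
        then have "num_columns P = num_columns (cells cs)"
          unfolding num_columns_def by (simp add: card_image inj_on_def)
        ultimately show "X \<in> cls ` L"
          using PV cs by (auto simp: V_def L_def area_def card_cells num_columns_cells)
      qed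
    qed
  qed
  then have "num_column_convex (Suc k) (Suc k + i) = card L"
    unfolding num_column_convex_def V_def[symmetric] by (simp add: bij_betw_same_card)
  also have "L = (\<Union>e\<le>i. column_lists k i 0 e)"
  proof -
    have "snd (hd cs) \<le> sum_list (map snd cs)" if "length cs = Suc k" for cs :: "(int \<times> nat) list"
      using that by (cases cs) auto
    then show ?thesis
      unfolding L_def column_lists_def by (auto simp: prod_eq_iff)
  qed
  finally show ?thesis .
qed

lemma column_lists_0: "column_lists 0 i b e = (if e = i then {[(b, e)]} else {})"
  by (auto simp: column_lists_def length_Suc_conv)

text \<open>Removing the first column leaves a list of the same kind; the row \<open>b'\<close> where the next column
  starts ranges over the positions in which it touches the removed one.\<close>

lemma column_lists_Suc:
  "column_lists (Suc k) i b e =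
     (if e \<le> i then (#) (b, e) ` (\<Union>e'\<le>i - e. \<Union>b'\<in>{b - int e' .. b + int e}. column_lists k (i - e) b' e')
      else {})" (is "?L = ?R")
proof (rule set_eqI)
  fix cs
  show "cs \<in> ?L \<longleftrightarrow> cs \<in> ?R"
  proof (cases "\<exists>c b' e' ds. cs = c # (b', e') # ds")
    case True
    then obtain c b' e' ds where cs: "cs = c # (b', e') # ds" by blast
    show ?thesis
      unfolding cs by (auto simp: column_lists_def image_iff columns_touch_iff)
  next
    case False
    have "cs \<notin> ?L"
      using False by (auto simp: column_lists_def length_Suc_conv)
    moreover have "cs \<notin> ?R"
    proof
      assume "cs \<in> ?R"
      then obtain b' e' ds where "cs = (b, e) # ds" "ds \<in> column_lists k (i - e) b' e'"
        by (auto split: if_splits)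
      with False show False
        by (auto simp: column_lists_def length_Suc_conv)
    qed
    ultimately show ?thesis by simp
  qed
qed

text \<open>The recursion that \<open>column_lists_Suc\<close> induces on cardinalities. The position \<open>b\<close> of the first
  column drops out, since only relative positions matter.\<close>

fun shape_count :: "nat \<Rightarrow> nat \<Rightarrow> nat \<Rightarrow> nat" where
  "shape_count 0 i e = (if e = i then 1 else 0)"
| "shape_count (Suc k) i e =
     (if e \<le> i then \<Sum>e'\<le>i - e. (1 + e + e') * shape_count k (i - e) e' else 0)"

lemma card_column_lists: "finite (column_lists k i b e) \<and> card (column_lists k i b e) = shape_count k i e"
proof (induction k arbitrary: i b e)
  case (Suc k)
  show ?case
  proof (cases "e \<le> i")
    case True
    have disj: "column_lists k (i - e) b1 e1 \<inter> column_lists k (i - e) b2 e2 = {}"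
      if "(b1, e1) \<noteq> (b2, e2)" for b1 e1 b2 e2
      using that by (auto simp: column_lists_def)
    have "card (\<Union>b'\<in>{b - int e' .. b + int e}. column_lists k (i - e) b' e')
        = (1 + e + e') * shape_count k (i - e) e'" for e'
    proof (subst card_UN_disjoint)
      have "card {b - int e' .. b + int e} = 1 + e + e'"
        by simp
      then show "(\<Sum>b'\<in>{b - int e' .. b + int e}. card (column_lists k (i - e) b' e'))
          = (1 + e + e') * shape_count k (i - e) e'"
        using Suc.IH by simp
    qed (use Suc.IH disj in auto)
    moreover have "card (\<Union>e'\<le>i - e. \<Union>b'\<in>{b - int e' .. b + int e}. column_lists k (i - e) b' e') =
        (\<Sum>e'\<le>i - e. card (\<Union>b'\<in>{b - int e' .. b + int e}. column_lists k (i - e) b' e'))"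
      by (rule card_UN_disjoint) (use Suc.IH in \<open>auto simp: column_lists_def\<close>)
    ultimately show ?thesis
      using True Suc.IH by (simp add: column_lists_Suc card_image)
  qed (simp add: column_lists_Suc)
qed (simp add: column_lists_0)

lemma num_column_convex_conv_shape_count:
  "num_column_convex (Suc k) (Suc k + i) = (\<Sum>e\<le>i. shape_count k i e)"
proof -
  have "card (\<Union>e\<le>i. column_lists k i 0 e) = (\<Sum>e\<le>i. card (column_lists k i 0 e))"
    by (rule card_UN_disjoint) (auto simp: card_column_lists, auto simp: column_lists_def)
  then show ?thesis
    unfolding num_column_convex_conv_lists by (simp add: card_column_lists)
qed

section \<open>Coefficients of powers of a power series\<close>

definition binomial_poly :: "nat \<Rightarrow> real poly" where
  "binomial_poly j = smult (1 / fact j) (\<Prod>l<j. [:- real l, 1:])"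

lemma poly_binomial_poly: "poly (binomial_poly j) (real k) = real (k choose j)"
proof -
  have "poly (binomial_poly j) (real k) = real k gchoose j"
    by (simp add: binomial_poly_def poly_prod gbinomial_prod_rev lessThan_atLeast0 add.commute)
  then show ?thesis
    by (simp add: binomial_gbinomial)
qed

lemma degree_binomial_poly: "degree (binomial_poly j) = j"
proof -
  have "degree (\<Prod>l<j. [:- real l, 1:]) = (\<Sum>l<j. degree [:- real l, 1:])"
    by (rule degree_prod_eq_sum_degree) auto
  then show ?thesis
    by (simp add: binomial_poly_def)
qed

lemma coeff_binomial_poly: "coeff (binomial_poly j) j = 1 / fact j"
proof -
  have "lead_coeff (binomial_poly j) = 1 / fact j"
    by (simp add: binomial_poly_def lead_coeff_smult lead_coeff_prod)
  then show ?thesis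
    by (simp add: degree_binomial_poly)
qed

text \<open>Write \<open>H = 1 + X * K\<close> and expand \<open>F * H ^ k\<close> as the sum of \<open>(k choose j) * X ^ j * F * K ^ j\<close>.
  Only \<open>j \<le> i\<close> contributes to the coefficient of \<open>X ^ i\<close>, and \<open>k choose j\<close> is a polynomial in \<open>k\<close> of
  degree \<open>j\<close>, so the coefficient at \<open>k ^ i\<close> comes from \<open>j = i\<close> alone.\<close>

lemma fps_nth_mult_power_polynomial:
  fixes F H :: "real fps"
  assumes "fps_nth H 0 = 1"
  shows "\<exists>p. degree p \<le> i \<and> coeff p i = fps_nth F 0 * fps_nth H 1 ^ i / fact i \<and>
           (\<forall>k. fps_nth (F * H ^ k) i = poly p (real k))"
proof -
  define K where "K = fps_shift 1 H"
  have H: "H = fps_X * K + 1"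
    using assms by (intro fps_ext) (auto simp: K_def)
  define p where "p = (\<Sum>j\<le>i. smult (fps_nth (F * K ^ j) (i - j)) (binomial_poly j))"
  have "fps_nth (F * H ^ k) i = poly p (real k)" for k
  proof -
    have "H ^ k = (\<Sum>j\<le>k. of_nat (k choose j) * (fps_X * K) ^ j)"
      unfolding H binomial_ring by simp
    then have "F * H ^ k = (\<Sum>j\<le>k. of_nat (k choose j) * (fps_X ^ j * (F * K ^ j)))"
      by (simp add: sum_distrib_left power_mult_distrib mult_ac)
    then have "fps_nth (F * H ^ k) i =
        (\<Sum>j\<le>k. real (k choose j) * fps_nth (fps_X ^ j * (F * K ^ j)) i)"
      by (simp add: fps_sum_nth fps_of_nat[symmetric] del: fps_of_nat)
    also have "\<dots> = (\<Sum>j\<le>i. real (k choose j) * fps_nth (fps_X ^ j * (F * K ^ j)) i)"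
      by (rule sum.mono_neutral_cong) (auto simp: fps_X_power_mult_nth)
    also have "\<dots> = poly p (real k)"
      by (simp add: p_def poly_sum poly_binomial_poly fps_X_power_mult_nth mult.commute)
    finally show ?thesis .
  qed
  moreover have "degree p \<le> i"
    unfolding p_def
    by (rule degree_sum_le) (auto intro: order.trans[OF degree_smult_le] simp: degree_binomial_poly)
  moreover have "coeff p i = fps_nth F 0 * fps_nth H 1 ^ i / fact i"
  proof -
    have "coeff p i = (\<Sum>j\<le>i. fps_nth (F * K ^ j) (i - j) * coeff (binomial_poly j) i)"
      by (simp add: p_def coeff_sum)
    also have "\<dots> = (\<Sum>j\<in>{i}. fps_nth (F * K ^ j) (i - j) * coeff (binomial_poly j) i)"
      by (rule sum.mono_neutral_right) (auto simp: coeff_eq_0 degree_binomial_poly)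
    finally show ?thesis
      by (simp add: coeff_binomial_poly fps_nth_power_0 K_def)
  qed
  ultimately show ?thesis by blast
qed

section \<open>The generating function and its characteristic roots\<close>

definition shape_series :: "nat \<Rightarrow> real fps" where
  "shape_series k = Abs_fps (\<lambda>i. \<Sum>e\<le>i. real (shape_count k i e))"

definition first_excess_series :: "nat \<Rightarrow> real fps" where
  "first_excess_series k = Abs_fps (\<lambda>i. \<Sum>e\<le>i. real e * real (shape_count k i e))"

text \<open>Splitting the factor \<open>1 + e + e'\<close> into \<open>e'\<close> and \<open>1 + e\<close> turns the recursion of \<open>shape_count\<close>
  into two Cauchy products. The function \<open>g\<close> covers both series at once: it is \<open>1\<close> for
  \<open>shape_series\<close> and the identity for \<open>first_excess_series\<close>.\<close>

lemma weighted_sum_shape_count_Suc: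
  "Abs_fps (\<lambda>i. \<Sum>e\<le>i. g e * real (shape_count (Suc k) i e)) =
     Abs_fps g * first_excess_series k + Abs_fps (\<lambda>e. g e * (1 + real e)) * shape_series k"
proof (rule fps_ext)
  fix i
  have "(\<Sum>e\<le>i. g e * real (shape_count (Suc k) i e)) =
      (\<Sum>e\<le>i. g e * fps_nth (first_excess_series k) (i - e)
              + g e * (1 + real e) * fps_nth (shape_series k) (i - e))"
    by (rule sum.cong)
      (auto simp: first_excess_series_def shape_series_def sum_distrib_left sum.distrib[symmetric]
         algebra_simps)
  then show "fps_nth (Abs_fps (\<lambda>i. \<Sum>e\<le>i. g e * real (shape_count (Suc k) i e))) i =
    fps_nth (Abs_fps g * first_excess_series k + Abs_fps (\<lambda>e. g e * (1 + real e)) * shape_series k) i"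
    by (simp add: fps_mult_nth sum.distrib atMost_atLeast0)
qed

lemma one_minus_X_mult_Abs_fps:
  fixes f :: "nat \<Rightarrow> 'a::comm_ring_1"
  shows "(1 - fps_X) * Abs_fps f = Abs_fps (\<lambda>n. if n = 0 then f 0 else f n - f (n - 1))"
  by (rule fps_ext) (auto simp: left_diff_distrib)

text \<open>The four series of a single column, summed as rational functions. Each factor \<open>1 - X\<close> takes
  differences of consecutive coefficients.\<close>

lemma column_series:
  defines "u \<equiv> 1 - fps_X :: real fps"
  shows "u * Abs_fps (\<lambda>e. 1) = 1"
    and "u\<^sup>2 * Abs_fps (\<lambda>e. 1 + real e) = 1"
    and "u\<^sup>2 * Abs_fps (\<lambda>e. real e) = fps_X"
    and "u ^ 3 * Abs_fps (\<lambda>e. real e * (1 + real e)) = 2 * fps_X"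
  unfolding u_def power2_eq_square power3_eq_cube mult.assoc one_minus_X_mult_Abs_fps
  by (rule fps_ext;
      auto simp: of_nat_diff numeral_fps_const algebra_simps eval_nat_numeral split: if_splits)+

lemma column_transfer:
  defines "u \<equiv> 1 - fps_X :: real fps"
  shows "u * shape_series 0 = 1"
    and "u\<^sup>2 * first_excess_series 0 = fps_X"
    and "u\<^sup>2 * shape_series (Suc k) = u * first_excess_series k + shape_series k"
    and "u ^ 3 * first_excess_series (Suc k) = fps_X * (u * first_excess_series k) + 2 * fps_X * shape_series k"
proof -
  note c = column_series[folded u_def]
  have "shape_series 0 = Abs_fps (\<lambda>e. 1)" "first_excess_series 0 = Abs_fps (\<lambda>e. real e)"
    by (auto simp: shape_series_def first_excess_series_def fps_eq_iff if_distrib cong: if_cong)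
  with c show "u * shape_series 0 = 1" "u\<^sup>2 * first_excess_series 0 = fps_X"
    by simp_all
  have S: "shape_series (Suc k) =
      Abs_fps (\<lambda>e. 1) * first_excess_series k + Abs_fps (\<lambda>e. 1 + real e) * shape_series k"
    using weighted_sum_shape_count_Suc[of "\<lambda>_. 1" k] by (simp add: shape_series_def)
  have "u\<^sup>2 * shape_series (Suc k) = u * (u * Abs_fps (\<lambda>e. 1)) * first_excess_series k
      + u\<^sup>2 * Abs_fps (\<lambda>e. 1 + real e) * shape_series k"
    unfolding S by (simp add: algebra_simps power2_eq_square)
  then show "u\<^sup>2 * shape_series (Suc k) = u * first_excess_series k + shape_series k"
    by (simp add: c)
  have T: "first_excess_series (Suc k) =
      Abs_fps real * first_excess_series k + Abs_fps (\<lambda>e. real e * (1 + real e)) * shape_series k"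
    using weighted_sum_shape_count_Suc[of real k] by (simp add: first_excess_series_def)
  have "u ^ 3 * first_excess_series (Suc k) = (u\<^sup>2 * Abs_fps real) * (u * first_excess_series k)
      + u ^ 3 * Abs_fps (\<lambda>e. real e * (1 + real e)) * shape_series k"
    unfolding T by (simp add: algebra_simps power2_eq_square power3_eq_cube)
  then show "u ^ 3 * first_excess_series (Suc k) = fps_X * (u * first_excess_series k) + 2 * fps_X * shape_series k"
    by (simp add: c)
qed

text \<open>The discriminant \<open>(1 + X)\<^sup>2 + 4 X\<close> of \<open>\<lambda>\<^sup>2 = (1 + X) \<lambda> + X\<close> has constant term \<open>1\<close>, hence a
  square root among the power series, and the quadratic formula applies.\<close>

lemma characteristic_roots:
  obtains \<alpha> \<beta> :: "real fps"
  where "\<alpha>\<^sup>2 = (1 + fps_X) * \<alpha> + fps_X" and "\<beta>\<^sup>2 = (1 + fps_X) * \<beta> + fps_X"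
    and "fps_nth \<alpha> 0 = 1" and "fps_nth \<alpha> 1 = 2" and "fps_nth \<beta> 0 = 0"
proof -
  define D :: "real fps" where "D = (1 + fps_X)\<^sup>2 + 4 * fps_X"
  define s where "s = fps_radical (\<lambda>n x. 1) 2 D"
  have D0: "fps_nth D 0 = 1"
    by (simp add: D_def power2_eq_square numeral_fps_const)
  have s0: "fps_nth s 0 = 1"
    using D0 by (simp add: s_def)
  have s2: "s\<^sup>2 = D"
    using power_radical[of D "\<lambda>n x. 1" 1] D0 by (simp add: s_def numeral_2_eq_2)
  define h :: "real fps" where "h = fps_const (1/2)"
  have h: "h * 2 = 1"
    by (simp add: h_def numeral_fps_const)
  define \<alpha> \<beta> where "\<alpha> = h * (1 + fps_X + s)" and "\<beta> = h * (1 + fps_X - s)"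
  have h2: "4 * h\<^sup>2 = 1"
    using h by algebra
  have a: "\<alpha>\<^sup>2 = (1 + fps_X) * \<alpha> + fps_X"
    using h h2 s2 unfolding \<alpha>_def D_def by algebra
  have b: "\<beta>\<^sup>2 = (1 + fps_X) * \<beta> + fps_X"
    using h h2 s2 unfolding \<beta>_def D_def by algebra
  have a0: "fps_nth \<alpha> 0 = 1" and b0: "fps_nth \<beta> 0 = 0"
    by (simp_all add: \<alpha>_def \<beta>_def h_def s0)
  \<comment> \<open>The linear coefficient of \<open>\<alpha>\<close> follows by comparing those of the two sides of its equation.\<close>
  have "fps_nth (\<alpha>\<^sup>2) 1 = 2 * fps_nth \<alpha> 1"
    by (simp add: power2_eq_square fps_mult_nth_1 a0)
  moreover have "fps_nth ((1 + fps_X) * \<alpha> + fps_X) 1 = fps_nth \<alpha> 1 + 2"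
    by (simp add: distrib_right a0)
  ultimately have "fps_nth \<alpha> 1 = 2"
    using a by simp
  with a b a0 b0 show ?thesis by (intro that)
qed

text \<open>After multiplication by suitable powers of \<open>u\<close>, adding a column acts on the pair of series by the
  matrix with rows \<open>(1, 1)\<close> and \<open>(2 X, X)\<close>. Its characteristic polynomial is
  \<open>\<lambda>\<^sup>2 - (1 + X) \<lambda> - X\<close>, and \<open>(1, \<lambda> - 1)\<close> is an eigenvector for the eigenvalue \<open>\<lambda>\<close>; the right-hand
  sides below are the difference of the two resulting geometric sequences.\<close>

lemma shape_series_closed_form:
  fixes \<alpha> \<beta> :: "real fps"
  defines "u \<equiv> 1 - fps_X :: real fps"
  assumes a: "\<alpha>\<^sup>2 = (1 + fps_X) * \<alpha> + fps_X" and b: "\<beta>\<^sup>2 = (1 + fps_X) * \<beta> + fps_X"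
  shows "(\<alpha> - \<beta>) * (u ^ (2 * k + 1) * shape_series k) = \<alpha> ^ Suc k - \<beta> ^ Suc k"
    and "(\<alpha> - \<beta>) * (u ^ (2 * k + 2) * first_excess_series k) = \<alpha> ^ Suc k * (\<alpha> - 1) - \<beta> ^ Suc k * (\<beta> - 1)"
proof (induction k)
  case 0
  note t = column_transfer(1,2)[folded u_def]
  { case 1
    show ?case using t by simp
  next
    case 2
    show ?case using t a b by simp algebra }
next
  case (Suc k)
  note t = column_transfer(3,4)[folded u_def, of k]
  { case 1
    have "u ^ (2 * Suc k + 1) * shape_series (Suc k) = u ^ (2 * k + 1) * (u\<^sup>2 * shape_series (Suc k))"
      by (simp add: power2_eq_square mult_ac)
    also have "\<dots> = u ^ (2 * k + 2) * first_excess_series k + u ^ (2 * k + 1) * shape_series k"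
      unfolding t by (simp add: algebra_simps)
    finally have *: "u ^ (2 * Suc k + 1) * shape_series (Suc k) =
        u ^ (2 * k + 2) * first_excess_series k + u ^ (2 * k + 1) * shape_series k" .
    show ?case
      unfolding * distrib_left Suc.IH by (simp add: algebra_simps)
  next
    case 2
    have "u ^ (2 * Suc k + 2) * first_excess_series (Suc k) =
        u ^ (2 * k + 1) * (u ^ 3 * first_excess_series (Suc k))"
      by (simp add: power3_eq_cube mult_ac)
    also have "\<dots> = fps_X * (u ^ (2 * k + 2) * first_excess_series k)
        + 2 * fps_X * (u ^ (2 * k + 1) * shape_series k)"
      unfolding t by (simp add: algebra_simps)
    finally have *: "(\<alpha> - \<beta>) * (u ^ (2 * Suc k + 2) * first_excess_series (Suc k)) =
        fps_X * ((\<alpha> - \<beta>) * (u ^ (2 * k + 2) * first_excess_series k))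
        + 2 * fps_X * ((\<alpha> - \<beta>) * (u ^ (2 * k + 1) * shape_series k))"
      by (simp add: algebra_simps)
    have "\<alpha> * (\<alpha> - 1) = fps_X * (\<alpha> + 1)" "\<beta> * (\<beta> - 1) = fps_X * (\<beta> + 1)"
      using a b by (simp_all add: power2_eq_square algebra_simps)
    then have "\<alpha> ^ Suc (Suc k) * (\<alpha> - 1) = \<alpha> ^ Suc k * (fps_X * (\<alpha> + 1))"
      "\<beta> ^ Suc (Suc k) * (\<beta> - 1) = \<beta> ^ Suc k * (fps_X * (\<beta> + 1))"
      by (metis mult.assoc mult.commute power_Suc)+
    then show ?case
      unfolding * Suc.IH by (simp add: algebra_simps) }
qed

text \<open>Up to the coefficient of \<open>X ^ i\<close>, the power of the root \<open>\<beta>\<close> is invisible for \<open>k \<ge> i\<close>, because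
  \<open>X ^ (k + 1)\<close> divides \<open>\<beta> ^ (k + 1)\<close>. The argument of the polynomial is the number \<open>k + 1\<close> of
  columns.\<close>

lemma shape_count_sum_polynomial:
  "\<exists>p. degree p = i \<and> coeff p i = 4 ^ i / fact i \<and>
     (\<forall>k\<ge>i. (\<Sum>e\<le>i. real (shape_count k i e)) = poly p (real (Suc k)))"
proof -
  define u where "u = (1 - fps_X :: real fps)"
  obtain \<alpha> \<beta> :: "real fps"
    where a: "\<alpha>\<^sup>2 = (1 + fps_X) * \<alpha> + fps_X" and b: "\<beta>\<^sup>2 = (1 + fps_X) * \<beta> + fps_X"
    and a0: "fps_nth \<alpha> 0 = 1" and a1: "fps_nth \<alpha> 1 = 2" and b0: "fps_nth \<beta> 0 = 0"
    by (rule characteristic_roots)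
  define A where "A = (Abs_fps (\<lambda>e. 1) :: real fps)"
  have uA: "u * A = 1"
    unfolding u_def A_def by (rule column_series)
  \<comment> \<open>The quotients \<open>u / (\<alpha> - \<beta>)\<close> and \<open>\<alpha> / u\<^sup>2\<close>.\<close>
  define F where "F = u * inverse (\<alpha> - \<beta>)"
  define H where "H = \<alpha> * A\<^sup>2"
  have ab: "inverse (\<alpha> - \<beta>) * (\<alpha> - \<beta>) = 1"
    by (rule inverse_mult_eq_1) (simp add: a0 b0)
  have H0: "fps_nth H 0 = 1" and H1: "fps_nth H 1 = 4" and F0: "fps_nth F 0 = 1"
    by (simp_all add: H_def F_def A_def u_def a0 a1[unfolded One_nat_def] b0 power2_eq_square fps_mult_nth_1)
  obtain p where p: "degree p \<le> i" "coeff p i = 4 ^ i / fact i"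
      "\<And>k. fps_nth (F * H ^ k) i = poly p (real k)"
    using fps_nth_mult_power_polynomial[OF H0, of i F] unfolding F0 H1 by auto
  have "(\<Sum>e\<le>i. real (shape_count k i e)) = poly p (real (Suc k))" if "i \<le> k" for k
  proof -
    have "shape_series k = (u * A) ^ (2 * k + 1) * (inverse (\<alpha> - \<beta>) * (\<alpha> - \<beta>)) * shape_series k"
      by (simp add: uA ab)
    also have "\<dots> = A ^ (2 * k + 1) * inverse (\<alpha> - \<beta>) * (\<alpha> ^ Suc k - \<beta> ^ Suc k)"
      unfolding shape_series_closed_form(1)[OF a b, folded u_def, symmetric]
      by (simp only: power_mult_distrib mult_ac)
    also have "A ^ (2 * k + 1) = (u * A) * A ^ (2 * k + 1)"
      by (simp add: uA)
    also have "\<dots> = u * (A\<^sup>2) ^ Suc k"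
    proof -
      have "(A\<^sup>2) ^ Suc k = A * A ^ (2 * k + 1)"
        unfolding power_mult[symmetric] by simp
      then show ?thesis
        by (simp only: mult.assoc)
    qed
    finally have "shape_series k = F * H ^ Suc k - F * (A\<^sup>2) ^ Suc k * \<beta> ^ Suc k"
      by (simp add: F_def H_def power_mult_distrib algebra_simps)
    moreover have "\<beta> = fps_X * fps_shift 1 \<beta>"
      using b0 by (intro fps_ext) auto
    then have "\<beta> ^ Suc k = fps_X ^ Suc k * fps_shift 1 \<beta> ^ Suc k"
      by (metis power_mult_distrib)
    ultimately have "shape_series k =
        F * H ^ Suc k - fps_X ^ Suc k * (F * (A\<^sup>2) ^ Suc k * fps_shift 1 \<beta> ^ Suc k)"
      by (simp only: mult_ac)
    then have "fps_nth (shape_series k) i = fps_nth (F * H ^ Suc k) i"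
      using that by (simp only: fps_sub_nth fps_X_power_mult_nth) simp
    then show ?thesis
      using p(3)[of "Suc k"] by (simp add: shape_series_def)
  qed
  moreover have "degree p = i"
    using p(1,2) le_degree[of p i] by simp
  ultimately show ?thesis
    using p(2) by blast
qed

theorem theorem5p2:
  fixes i :: nat
  shows "\<exists>p :: real poly. degree p = i \<and> coeff p i = 4 ^ i / fact i \<and>
           (\<forall>k::nat. k \<ge> i + 1 \<longrightarrow> real (num_column_convex k (k + i)) = poly p (real k))"
proof -
  obtain p where p: "degree p = i" "coeff p i = 4 ^ i / fact i"
      and val: "\<And>k. k \<ge> i \<Longrightarrow> (\<Sum>e\<le>i. real (shape_count k i e)) = poly p (real (Suc k))"
    using shape_count_sum_polynomial[of i] by blast
  have "real (num_column_convex k (k + i)) = poly p (real k)" if ik: "k \<ge> i + 1" for k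
  proof -
    obtain k' where k': "k = Suc k'" "k' \<ge> i"
      using ik by (cases k) auto
    show ?thesis
      unfolding k'(1) num_column_convex_conv_shape_count of_nat_sum by (rule val[OF k'(2)])
  qed
  with p show ?thesis by blast
qed

end
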